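(* Let $N\ge 1$ be an integer and $\beta\ge 0$. If $\Omega_1$ and $\Omega_2$ are boxes in $\mathbb{R}^N$ with $\Omega_1\subseteq\Omega_2$, then $\lambda_1(\Omega_1)\ge\lambda_1(\Omega_2)$.
   Context: A box is a set $\Omega(\mathbf a)=(-a_1,a_1)\times\cdots\times(-a_N,a_N)\subset\mathbb{R}^N$ with all $a_j>0$. For given $\beta\ge 0$, $\lambda_1(\Omega)$ denotes the fundamental (smallest) Robin eigenvalue of the Laplacian, i.e. the smallest $\lambda$ for which there is a function $u$, not identically zero, with $\Delta u+\lambda u=0$ in $\Omega$ and $\beta\,\partial u/\partial n+u=0$ on $\partial\Omega$ ($n$ the outward normal). For boxes it is given by the explicit formula $$\lambda_1(\Omega(\mathbf a))=\sum_{j=1}^N\mu(a_j)^2,$$ where, if $\beta>0$, $\mu(c)$ is the unique solution in $(0,\pi/(2c))$ of $\mu\tan(c\mu)=1/\beta$, and, if $\beta=0$, $\mu(c)=\pi/(2c)$. *)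

theory Defs
  imports "HOL-Analysis.Analysis"
begin

text \<open>
  Unit outward normals, defined through the directions that enter and leave the set, so that
  \<open>n\<close> is unique when it exists.  On a box, a normal exists exactly at the boundary points that lie
  in the relative interior of a face; there is none at points where several faces meet.
\<close>
definition outward_normal :: "'a::euclidean_space set \<Rightarrow> 'a \<Rightarrow> 'a \<Rightarrow> bool" where
  "outward_normal \<Omega> x n \<longleftrightarrow>
     x \<in> frontier \<Omega> \<and> norm n = 1 \<and>
     (\<forall>v. v \<bullet> n < 0 \<longrightarrow> (\<forall>\<^sub>F t in at_right 0. x + t *\<^sub>R v \<in> \<Omega>)) \<and>
     (\<forall>v. v \<bullet> n > 0 \<longrightarrow> (\<forall>\<^sub>F t in at_right 0. x + t *\<^sub>R v \<notin> closure \<Omega>))"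

text \<open>
  Classical eigenfunctions: \<open>u\<close> is of class \<open>C\<^sup>2\<close> in the open set \<open>\<Omega>\<close>, with gradient \<open>g\<close> and
  Hessian matrix \<open>H\<close> (so \<open>trace (H x)\<close> is the Laplacian), and continuous up to the boundary.  If
  \<open>\<beta> \<noteq> 0\<close>, it is moreover of class \<open>C\<^sup>1\<close> up to the boundary, so that \<open>g x \<bullet> n\<close> is the normal
  derivative; if \<open>\<beta> = 0\<close>, the values of \<open>g\<close> on the boundary are irrelevant and the boundary
  condition reads \<open>u x = 0\<close>.
\<close>
definition robin_eigenfunction ::
    "real \<Rightarrow> (real ^ 'n) set \<Rightarrow> real \<Rightarrow> (real ^ 'n \<Rightarrow> real) \<Rightarrow> bool" where
  "robin_eigenfunction \<beta> \<Omega> lam u \<longleftrightarrow>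
     (\<exists>x\<in>\<Omega>. u x \<noteq> 0) \<and>
     continuous_on (closure \<Omega>) u \<and>
     (\<exists>(g :: real ^ 'n \<Rightarrow> real ^ 'n) (H :: real ^ 'n \<Rightarrow> real ^ 'n ^ 'n).
        (\<forall>x\<in>\<Omega>. (u has_derivative (\<lambda>h. g x \<bullet> h)) (at x)) \<and>
        (\<forall>x\<in>\<Omega>. (g has_derivative (\<lambda>h. H x *v h)) (at x)) \<and>
        continuous_on \<Omega> H \<and>
        (\<beta> \<noteq> 0 \<longrightarrow> continuous_on (closure \<Omega>) g \<and>
           (\<forall>x\<in>closure \<Omega>. (u has_derivative (\<lambda>h. g x \<bullet> h)) (at x within closure \<Omega>))) \<and>
        (\<forall>x\<in>\<Omega>. trace (H x) + lam * u x = 0) \<and>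
        (\<forall>x n. outward_normal \<Omega> x n \<longrightarrow> \<beta> * (g x \<bullet> n) + u x = 0))"

definition robin_eigenvalue :: "real \<Rightarrow> (real ^ 'n) set \<Rightarrow> real \<Rightarrow> bool" where
  "robin_eigenvalue \<beta> \<Omega> lam \<longleftrightarrow> (\<exists>u. robin_eigenfunction \<beta> \<Omega> lam u)"

definition fundamental_eigenvalue :: "real \<Rightarrow> (real ^ 'n) set \<Rightarrow> real" where
  "fundamental_eigenvalue \<beta> \<Omega> = (LEAST lam. robin_eigenvalue \<beta> \<Omega> lam)"

definition centered_box :: "real ^ 'n \<Rightarrow> (real ^ 'n) set" where
  "centered_box a = {x. \<forall>j. - (a $ j) < x $ j \<and> x $ j < a $ j}"

definition is_centered_box :: "(real ^ 'n) set \<Rightarrow> bool" where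
  "is_centered_box \<Omega> \<longleftrightarrow> (\<exists>a. (\<forall>j. 0 < a $ j) \<and> \<Omega> = centered_box a)"

end

theory Submission imports Defs begin

text \<open>
  The eigenvalue problem on a box separates.  For a half-width \<open>c\<close>, let \<open>\<mu>(c)\<close> be the zero of
  \<open>cos (\<nu> c) - \<beta> \<nu> sin (\<nu> c)\<close> in \<open>(0, \<pi>/(2c)]\<close>; this is the equation
  \<open>\<nu> tan (c \<nu>) = 1/\<beta>\<close> cleared of denominators, so that \<open>\<beta> = 0\<close> is covered as well.  The product of
  the functions \<open>cos (\<mu>(a\<^sub>j) x\<^sub>j)\<close> is an eigenfunction with eigenvalue \<open>\<Lambda> = \<Sum> \<mu>(a\<^sub>j)\<^sup>2\<close>
  (\<open>cosine_mode_eigenfunction\<close>).  Once \<open>\<Lambda>\<close> is known to be the least eigenvalue, the theorem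
  reduces to \<open>\<mu>\<close> being decreasing (\<open>robin_frequency_antimono\<close>), since inclusion of centered boxes
  is the componentwise order of their half-widths.

  That no eigenvalue lies below \<open>\<Lambda>\<close> is a maximum principle.  Take frequencies \<open>\<nu>\<^sub>j\<close> slightly
  below \<open>\<mu>(a\<^sub>j)\<close>, and let \<open>w = \<Prod> cos (\<nu>\<^sub>j x\<^sub>j)\<close>.  It is positive up to the boundary, satisfies
  \<open>\<Delta>w = - (\<Sum> \<nu>\<^sub>j\<^sup>2) w\<close>, and has \<open>\<beta> \<partial>w/\<partial>n + w > 0\<close> on each face.  If \<open>u\<close> is an eigenfunction with
  eigenvalue \<open>lam\<close> that is positive somewhere (one of \<open>u\<close>, \<open>- u\<close> is) and \<open>M > 0\<close> is the maximum of
  \<open>u/w\<close>, then \<open>z = u - M w\<close> is nonpositive and vanishes at a point \<open>x\<close>.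
  If \<open>x\<close> is interior, then \<open>0 \<ge> \<Delta>z(x) = (\<Sum> \<nu>\<^sub>j\<^sup>2 - lam) M w(x)\<close>, so \<open>lam \<ge> \<Sum> \<nu>\<^sub>j\<^sup>2\<close>.
  If \<open>x\<close> is on a face, then \<open>\<beta> \<partial>z/\<partial>n(x) < 0\<close>, which is impossible at a maximum.  The strict sign
  on the boundary comes from lowering the frequencies; letting \<open>\<nu>\<^sub>j\<close> tend to \<open>\<mu>(a\<^sub>j)\<close> then gives
  \<open>\<Lambda> \<le> lam\<close>.  Edges and corners, where there is no normal, are handled by continuity
  (\<open>robin_condition_on_closed_faces\<close>).
\<close>

section \<open>Separable products and cosine modes\<close>

definition separable_product :: "('n::finite \<Rightarrow> real \<Rightarrow> real) \<Rightarrow> real ^ 'n \<Rightarrow> real" where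
  "separable_product f x = (\<Prod>j\<in>UNIV. f j (x $ j))"

lemma separable_product_upd:
  "separable_product (f(i := p)) x = p (x $ i) * (\<Prod>j\<in>UNIV - {i}. f j (x $ j))"
  unfolding separable_product_def
  by (subst prod.remove[of UNIV i]) auto

lemma separable_product_remove:
  "separable_product f x = f i (x $ i) * (\<Prod>j\<in>UNIV - {i}. f j (x $ j))"
  using separable_product_upd[of f i "f i" x] by simp

text \<open>
  Each partial derivative is again a separable product, with one factor replaced by its derivative.
  Second derivatives are therefore obtained by applying this rule twice.
\<close>
lemma has_derivative_separable_product:
  assumes "\<And>i. (f i has_real_derivative f' i (x $ i)) (at (x $ i))"
  shows "(separable_product f has_derivative
           (\<lambda>h. (\<chi> i. separable_product (f(i := f' i)) x) \<bullet> h)) (at x)"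
proof -
  have 1: "((\<lambda>x. f i (x $ i)) has_derivative (\<lambda>h. f' i (x $ i) * (h $ i))) (at x)" for i
    using has_derivative_compose[OF bounded_linear_imp_has_derivative[OF bounded_linear_vec_nth[of i]],
        where g = "f i" and g' = "\<lambda>t. f' i (x $ i) * t"]
      assms[of i] by (simp add: has_field_derivative_def)
  have "((\<lambda>x. \<Prod>i\<in>UNIV. f i (x $ i)) has_derivative
     (\<lambda>h. \<Sum>i\<in>UNIV. f' i (x $ i) * (h $ i) * (\<Prod>j\<in>UNIV - {i}. f j (x $ j)))) (at x)"
    by (rule has_derivative_prod) (use 1 in auto)
  then show ?thesis
    unfolding separable_product_upd
    by (simp add: separable_product_def[abs_def] inner_vec_def mult_ac)
qed

lemma continuous_on_separable_product:
  assumes "\<And>j. continuous_on UNIV (f j)"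
  shows "continuous_on S (separable_product f)"
  unfolding separable_product_def
  by (intro continuous_on_prod continuous_on_compose2[OF assms] continuous_intros) auto

definition cosine_mode :: "('n::finite \<Rightarrow> real) \<Rightarrow> real ^ 'n \<Rightarrow> real" where
  "cosine_mode \<nu> = separable_product (\<lambda>j t. cos (\<nu> j * t))"

lemma cosine_mode_remove:
  "cosine_mode \<nu> x = cos (\<nu> j * x $ j) * (\<Prod>i\<in>UNIV - {j}. cos (\<nu> i * x $ i))"
  unfolding cosine_mode_def by (rule separable_product_remove)

definition cosine_mode_grad :: "('n::finite \<Rightarrow> real) \<Rightarrow> real ^ 'n \<Rightarrow> real ^ 'n" where
  "cosine_mode_grad \<nu> x =
     (\<chi> i. separable_product ((\<lambda>j t. cos (\<nu> j * t))(i := \<lambda>t. - \<nu> i * sin (\<nu> i * t))) x)"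

text \<open>
  Row \<open>i\<close> is the gradient of component \<open>i\<close> of the gradient, whose \<open>i\<close>-th factor is already a sine.
  Differentiating that factor once more gives the cosine in the inner update; it is selected
  exactly on the diagonal \<open>k = i\<close>.
\<close>
definition cosine_mode_hess :: "('n::finite \<Rightarrow> real) \<Rightarrow> real ^ 'n \<Rightarrow> real ^ 'n ^ 'n" where
  "cosine_mode_hess \<nu> x =
     (\<chi> i k. separable_product
        (((\<lambda>j t. cos (\<nu> j * t))(i := \<lambda>t. - \<nu> i * sin (\<nu> i * t)))
          (k := (((\<lambda>j t. - \<nu> j * sin (\<nu> j * t))(i := \<lambda>t. - (\<nu> i)\<^sup>2 * cos (\<nu> i * t))) k))) x)"

lemma has_derivative_cosine_mode:
  "(cosine_mode \<nu> has_derivative (\<lambda>h. cosine_mode_grad \<nu> x \<bullet> h)) (at x)"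
  unfolding cosine_mode_def cosine_mode_grad_def
  by (rule has_derivative_separable_product) (auto intro!: derivative_eq_intros)

lemma has_derivative_vec_components:
  fixes F :: "'a::real_normed_vector \<Rightarrow> real ^ 'n"
  assumes "\<And>i. ((\<lambda>x. F x $ i) has_derivative (\<lambda>h. F' h $ i)) (at x)"
  shows "(F has_derivative F') (at x)"
  unfolding has_derivative_componentwise_within[of F F' x UNIV]
  using assms by (auto simp: Basis_vec_def inner_axis)

lemma has_derivative_cosine_mode_grad:
  "(cosine_mode_grad \<nu> has_derivative (\<lambda>h. cosine_mode_hess \<nu> x *v h)) (at x)"
proof (rule has_derivative_vec_components)
  fix i
  let ?f = "(\<lambda>j t. cos (\<nu> j * t))(i := \<lambda>t. - \<nu> i * sin (\<nu> i * t))"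
  let ?f' = "(\<lambda>j t. - \<nu> j * sin (\<nu> j * t))(i := \<lambda>t. - (\<nu> i)\<^sup>2 * cos (\<nu> i * t))"
  have "(separable_product ?f has_derivative
           (\<lambda>h. (\<chi> k. separable_product (?f(k := ?f' k)) x) \<bullet> h)) (at x)"
    by (rule has_derivative_separable_product)
       (auto intro!: derivative_eq_intros simp: power2_eq_square)
  then show "((\<lambda>x. cosine_mode_grad \<nu> x $ i) has_derivative
               (\<lambda>h. (cosine_mode_hess \<nu> x *v h) $ i)) (at x)"
    by (simp add: cosine_mode_grad_def cosine_mode_hess_def matrix_vector_mult_def inner_vec_def)
qed

lemma continuous_on_cosine_mode: "continuous_on S (cosine_mode \<nu>)"
  by (rule has_derivative_continuous_on[OF has_derivative_at_withinI[OF has_derivative_cosine_mode]])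

lemma continuous_on_cosine_mode_grad: "continuous_on S (cosine_mode_grad \<nu>)"
  by (rule has_derivative_continuous_on[OF has_derivative_at_withinI[OF has_derivative_cosine_mode_grad]])

lemma continuous_on_cosine_mode_hess: "continuous_on S (cosine_mode_hess \<nu>)"
  unfolding cosine_mode_hess_def
proof (intro continuous_on_vec_lambda continuous_on_separable_product)
  fix i k j
  let ?f = "((\<lambda>j t. cos (\<nu> j * t))(i := \<lambda>t. - \<nu> i * sin (\<nu> i * t)))
    (k := (((\<lambda>j t. - \<nu> j * sin (\<nu> j * t))(i := \<lambda>t. - (\<nu> i)\<^sup>2 * cos (\<nu> i * t))) k))"
  have "continuous_on UNIV (\<lambda>t. cos (c * t))" "continuous_on UNIV (\<lambda>t. - c * sin (c * t))"
    "continuous_on UNIV (\<lambda>t. - c\<^sup>2 * cos (c * t))" for c :: real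
    by (intro continuous_intros)+
  then show "continuous_on UNIV (?f j)"
    by (cases "j = k"; cases "k = i"; cases "j = i")
       (simp_all only: fun_upd_apply if_True if_False refl)
qed

lemma trace_cosine_mode_hess:
  "trace (cosine_mode_hess \<nu> x) = - (\<Sum>j\<in>UNIV. (\<nu> j)\<^sup>2) * cosine_mode \<nu> x"
proof -
  have "cosine_mode_hess \<nu> x $ j $ j = - (\<nu> j)\<^sup>2 * cosine_mode \<nu> x" for j
  proof -
    have "cosine_mode_hess \<nu> x $ j $ j =
        separable_product ((\<lambda>j t. cos (\<nu> j * t))(j := \<lambda>t. - (\<nu> j)\<^sup>2 * cos (\<nu> j * t))) x"
      by (simp only: cosine_mode_hess_def vec_lambda_beta fun_upd_same fun_upd_upd)
    also have "\<dots> = - (\<nu> j)\<^sup>2 * cosine_mode \<nu> x"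
      by (simp only: separable_product_upd cosine_mode_remove[of _ _ j] mult.assoc)
    finally show ?thesis .
  qed
  then show ?thesis
    by (simp add: trace_def sum_distrib_right sum_negf)
qed

text \<open>
  The value of \<open>\<beta> f' + f\<close> at \<open>c\<close> for \<open>f t = cos (\<nu> t)\<close>: its zeros are the Robin frequencies of the
  interval \<open>(-c, c)\<close> with even eigenfunctions, and its positivity says that \<open>f\<close> is a strict
  supersolution for the boundary condition.
\<close>
definition robin_defect :: "real \<Rightarrow> real \<Rightarrow> real \<Rightarrow> real" where
  "robin_defect \<beta> c \<nu> = cos (\<nu> * c) - \<beta> * \<nu> * sin (\<nu> * c)"

text \<open>
  On the face with outward normal \<open>s e\<^sub>j\<close>, only the \<open>j\<close>-th factor is differentiated, so the Robin
  operator acts on that factor alone.  The same identity serves twice: at the zeros of the defect it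
  gives the boundary condition of the eigenfunction, and below them the sign of the barrier.
\<close>
lemma cosine_mode_boundary_operator:
  fixes x :: "real ^ 'n"
  assumes "\<bar>s\<bar> = 1" "x $ j = s * c"
  shows "\<beta> * (s * cosine_mode_grad \<nu> x $ j) + cosine_mode \<nu> x
         = robin_defect \<beta> c (\<nu> j) * (\<Prod>i\<in>UNIV - {j}. cos (\<nu> i * x $ i))"
proof -
  have s: "s = 1 \<or> s = -1" using assms(1) by linarith
  have "cosine_mode_grad \<nu> x $ j =
      - \<nu> j * sin (\<nu> j * x $ j) * (\<Prod>i\<in>UNIV - {j}. cos (\<nu> i * x $ i))"
    by (simp only: cosine_mode_grad_def vec_lambda_beta separable_product_upd)
  then show ?thesis
    unfolding cosine_mode_remove[of \<nu> x j]
    using s by (auto simp: assms(2) robin_defect_def algebra_simps)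
qed

section \<open>One-dimensional frequencies\<close>

lemma robin_defect_strict_antimono:
  assumes "0 \<le> \<beta>" "0 < c" "0 \<le> \<nu>" "\<nu> < \<nu>'" "\<nu>' \<le> pi / (2 * c)"
  shows "robin_defect \<beta> c \<nu>' < robin_defect \<beta> c \<nu>"
proof -
  have le: "\<nu>' * c \<le> pi / 2" using assms by (simp add: field_simps)
  have lt: "\<nu> * c < \<nu>' * c" and ge: "0 \<le> \<nu> * c" using assms by auto
  have "cos (\<nu>' * c) < cos (\<nu> * c)"
    using le lt ge by (intro cos_monotone_0_pi) auto
  moreover have "sin (\<nu> * c) \<le> sin (\<nu>' * c)"
    using le lt ge by (intro sin_monotone_2pi_le) auto
  then have "\<nu> * sin (\<nu> * c) \<le> \<nu>' * sin (\<nu>' * c)"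
    using assms le lt ge pi_gt_zero by (intro mult_mono sin_ge_zero) linarith+
  then have "\<beta> * (\<nu> * sin (\<nu> * c)) \<le> \<beta> * (\<nu>' * sin (\<nu>' * c))"
    using assms(1) by (rule mult_left_mono)
  ultimately show ?thesis unfolding robin_defect_def by (simp add: mult.assoc)
qed

text \<open>
  The number \<open>\<mu>(c)\<close>.  For \<open>\<beta> = 0\<close> the defect is \<open>cos (\<nu> c)\<close> and the zero is the endpoint \<open>\<pi>/(2c)\<close>,
  hence the half-closed range.  The zero is unique by strict monotonicity of the defect.
\<close>
definition robin_frequency :: "real \<Rightarrow> real \<Rightarrow> real" where
  "robin_frequency \<beta> c = (SOME \<nu>. 0 < \<nu> \<and> \<nu> \<le> pi / (2 * c) \<and> robin_defect \<beta> c \<nu> = 0)"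

lemma robin_frequency:
  assumes "0 \<le> \<beta>" "0 < c"
  shows "0 < robin_frequency \<beta> c" "robin_frequency \<beta> c \<le> pi / (2 * c)"
    "robin_defect \<beta> c (robin_frequency \<beta> c) = 0"
proof -
  have "robin_defect \<beta> c (pi / (2 * c)) \<le> 0" "0 \<le> robin_defect \<beta> c 0"
    using assms by (auto simp: robin_defect_def)
  moreover have "continuous_on {0..pi / (2 * c)} (robin_defect \<beta> c)"
    unfolding robin_defect_def[abs_def] by (intro continuous_intros)
  ultimately obtain \<nu> where \<nu>: "0 \<le> \<nu>" "\<nu> \<le> pi / (2 * c)" "robin_defect \<beta> c \<nu> = 0"
    using IVT2'[of "robin_defect \<beta> c" "pi / (2 * c)" 0 0] assms by auto
  moreover have "\<nu> \<noteq> 0" using \<nu>(3) by (auto simp: robin_defect_def)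
  ultimately have "\<exists>\<nu>. 0 < \<nu> \<and> \<nu> \<le> pi / (2 * c) \<and> robin_defect \<beta> c \<nu> = 0"
    by (metis order_le_less)
  from someI_ex[OF this, folded robin_frequency_def]
  show "0 < robin_frequency \<beta> c" "robin_frequency \<beta> c \<le> pi / (2 * c)"
    "robin_defect \<beta> c (robin_frequency \<beta> c) = 0" by auto
qed

text \<open>
  The defect decreases in \<open>c\<close> as well as in \<open>\<nu>\<close>, as long as the angle \<open>\<nu> c\<close> stays in \<open>[0, \<pi>/2]\<close>.
  So if \<open>\<mu>(d)\<close> exceeded \<open>\<mu>(c)\<close>, the defect for \<open>d\<close> would still be positive at \<open>\<mu>(c)\<close>, whereas it is
  at most the defect for \<open>c\<close>, which vanishes there.
\<close>
lemma robin_frequency_antimono: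
  assumes "0 \<le> \<beta>" "0 < c" "c \<le> d"
  shows "robin_frequency \<beta> d \<le> robin_frequency \<beta> c"
proof (rule ccontr)
  let ?m = "robin_frequency \<beta> c" and ?n = "robin_frequency \<beta> d"
  assume "\<not> ?n \<le> ?m"
  then have lt: "?m < ?n" by simp
  note m = robin_frequency[OF assms(1,2)]
  have d: "0 < d" using assms by simp
  note n = robin_frequency[OF assms(1) d]
  have md: "?m * d \<le> pi / 2"
  proof -
    have "?m * d \<le> ?n * d" using lt d by simp
    also have "\<dots> \<le> pi / 2" using n(2) d by (simp add: field_simps)
    finally show ?thesis .
  qed
  have mc: "0 \<le> ?m * c" "?m * c \<le> ?m * d" using m assms by auto
  have "0 < robin_defect \<beta> d ?m"
    using robin_defect_strict_antimono[OF assms(1) d _ lt n(2)] n(3) m(1) by simp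
  also have "robin_defect \<beta> d ?m \<le> robin_defect \<beta> c ?m"
  proof -
    have "cos (?m * d) \<le> cos (?m * c)" using md mc by (intro cos_monotone_0_pi_le) auto
    moreover have "sin (?m * c) \<le> sin (?m * d)"
      using md mc by (intro sin_monotone_2pi_le) auto
    then have "\<beta> * ?m * sin (?m * c) \<le> \<beta> * ?m * sin (?m * d)"
      using assms m(1) by (intro mult_left_mono) auto
    ultimately show ?thesis by (simp add: robin_defect_def)
  qed
  finally show False using m(3) by simp
qed

section \<open>Geometry of a centered box\<close>

lemma centered_box_eq_box: "centered_box a = box (- a) a"
  by (auto simp: centered_box_def mem_box_cart)

lemma open_centered_box: "open (centered_box a)"
  by (simp add: centered_box_eq_box open_box)

lemma closure_centered_box:
  assumes "\<forall>j. 0 < a $ j"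
  shows "closure (centered_box a) = {x. \<forall>j. \<bar>x $ j\<bar> \<le> a $ j}"
proof -
  have "0 \<in> box (- a) a" using assms by (simp add: mem_box_cart)
  then have "box (- a) a \<noteq> {}" by blast
  then have "closure (centered_box a) = cbox (- a) a"
    by (simp add: centered_box_eq_box)
  also have "\<dots> = {x. \<forall>j. \<bar>x $ j\<bar> \<le> a $ j}"
    by (auto simp: set_eq_iff mem_box_cart abs_le_iff minus_le_iff)
  finally show ?thesis .
qed

text \<open>
  Faces are indexed by an axis \<open>j\<close> and a sign \<open>s\<close> (\<open>\<bar>s\<bar> = 1\<close>), so that opposite faces are treated
  together.
\<close>
lemma frontier_centered_box:
  assumes "\<forall>j. 0 < a $ j"
  shows "x \<in> frontier (centered_box a) \<longleftrightarrow>
         x \<in> closure (centered_box a) \<and> (\<exists>j s. \<bar>s\<bar> = 1 \<and> x $ j = s * a $ j)"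
proof -
  have "(\<exists>s. \<bar>s\<bar> = 1 \<and> x $ j = s * a $ j) \<longleftrightarrow> \<bar>x $ j\<bar> = a $ j" for j
  proof
    assume "\<bar>x $ j\<bar> = a $ j"
    then have "\<bar>sgn (x $ j)\<bar> = 1 \<and> x $ j = sgn (x $ j) * a $ j"
      using assms[rule_format, of j] by (auto simp: sgn_if split: if_splits)
    then show "\<exists>s. \<bar>s\<bar> = 1 \<and> x $ j = s * a $ j" by blast
  qed (use assms[rule_format, of j] in \<open>auto simp: abs_mult\<close>)
  moreover have "x \<in> centered_box a \<longleftrightarrow> (\<forall>j. \<bar>x $ j\<bar> < a $ j)"
    unfolding centered_box_def mem_Collect_eq by (rule iff_allI) linarith
  ultimately show ?thesis
    unfolding frontier_def interior_open[OF open_centered_box] closure_centered_box[OF assms]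
    by (simp add: not_less) (metis order_antisym order_refl)
qed

lemma outward_normal_centered_box_face:
  assumes a: "\<forall>j. 0 < a $ j" and s: "\<bar>s\<bar> = 1" and xj: "x $ j = s * a $ j"
    and xi: "\<And>i. i \<noteq> j \<Longrightarrow> \<bar>x $ i\<bar> < a $ i"
  shows "outward_normal (centered_box a) x (axis j s)"
  unfolding outward_normal_def
proof (intro conjI allI impI)
  have s': "s = 1 \<or> s = -1" using s by linarith
  have "\<bar>x $ i\<bar> \<le> a $ i" for i
    using xi[of i] xj s' a[rule_format, of j] by (cases "i = j") auto
  then show "x \<in> frontier (centered_box a)"
    using s xj by (auto simp: frontier_centered_box[OF a] closure_centered_box[OF a])
  show "norm (axis j s) = 1" using s by (simp add: norm_eq_sqrt_inner inner_axis_axis flip: power2_eq_square)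
next
  have s': "s = 1 \<or> s = -1" using s by linarith
  fix v :: "real ^ 'a"
  assume v: "v \<bullet> axis j s < 0"
  have sv: "s * v $ j < 0" using v by (simp add: inner_axis mult.commute)
  have lim: "((\<lambda>t. (x + t *\<^sub>R v) $ i) \<longlongrightarrow> (x + 0 *\<^sub>R v) $ i) (at_right 0)" for i
    by (intro tendsto_intros)
  have "\<forall>\<^sub>F t in at_right 0. - (a $ i) < (x + t *\<^sub>R v) $ i \<and> (x + t *\<^sub>R v) $ i < a $ i" for i
  proof (cases "i = j")
    case False
    then show ?thesis using xi[of i] lim[of i]
      by (intro eventually_conj order_tendstoD[OF lim[of i]]) auto
  next
    case True
    have "((\<lambda>t. s * (x + t *\<^sub>R v) $ j) \<longlongrightarrow> s * (x + 0 *\<^sub>R v) $ j) (at_right 0)"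
      by (intro tendsto_intros)
    moreover have "s * (x + 0 *\<^sub>R v) $ j = a $ j" using s' xj by auto
    ultimately have "\<forall>\<^sub>F t in at_right 0. - (a $ j) < s * (x + t *\<^sub>R v) $ j"
      using a[rule_format, of j] by (intro order_tendstoD) auto
    moreover have "\<forall>\<^sub>F t in at_right (0::real). 0 < t" by (simp add: eventually_at_right_less)
    ultimately show ?thesis
    proof eventually_elim
      case (elim t)
      have "t * (s * v $ j) < 0" using elim sv by (simp add: mult_pos_neg)
      then show ?case using elim xj s' True by auto
    qed
  qed
  then have "\<forall>\<^sub>F t in at_right 0. \<forall>i. - (a $ i) < (x + t *\<^sub>R v) $ i \<and> (x + t *\<^sub>R v) $ i < a $ i"
    by (simp add: eventually_all_finite)
  then show "\<forall>\<^sub>F t in at_right 0. x + t *\<^sub>R v \<in> centered_box a"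
    unfolding centered_box_def by simp
next
  have s': "s = 1 \<or> s = -1" using s by linarith
  fix v :: "real ^ 'a"
  assume v: "v \<bullet> axis j s > 0"
  have sv: "s * v $ j > 0" using v by (simp add: inner_axis mult.commute)
  have "\<forall>\<^sub>F t in at_right (0::real). 0 < t" by (simp add: eventually_at_right_less)
  then show "\<forall>\<^sub>F t in at_right 0. x + t *\<^sub>R v \<notin> closure (centered_box a)"
  proof eventually_elim
    case (elim t)
    have "t * (s * v $ j) > 0" using elim sv by simp
    then have "\<not> \<bar>(x + t *\<^sub>R v) $ j\<bar> \<le> a $ j" using xj s' by auto
    then show ?case unfolding closure_centered_box[OF a] by blast
  qed
qed

text \<open>
  A frontier point lies on some closed face \<open>x\<^sub>j = s a\<^sub>j\<close>.  The directions in the open half-space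
  \<open>v \<bullet> n < 0\<close> enter the box, and entering the box forces \<open>s v\<^sub>j < 0\<close>.  An open half-space contained
  in another one with the origin on both boundaries must coincide with it, so \<open>n = s e\<^sub>j\<close>.
\<close>
lemma outward_normal_centered_boxE:
  assumes a: "\<forall>j. 0 < a $ j" and n: "outward_normal (centered_box a) x n"
  obtains j s where "\<bar>s\<bar> = 1" "x $ j = s * a $ j" "n = axis j s"
proof -
  obtain j s where s: "\<bar>s\<bar> = 1" and xj: "x $ j = s * a $ j"
    using n by (auto simp: outward_normal_def frontier_centered_box[OF a])
  have s': "s = 1 \<or> s = -1" using s by linarith
  have n1: "norm n = 1" using n by (simp add: outward_normal_def)
  then have nn: "n \<bullet> n = 1" by (simp add: norm_eq_1)
  have half: "s * v $ j < 0" if "v \<bullet> n < 0" for v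
  proof -
    have "\<forall>\<^sub>F t in at_right 0. x + t *\<^sub>R v \<in> centered_box a"
      using n that by (simp add: outward_normal_def)
    moreover have "\<forall>\<^sub>F t in at_right (0::real). 0 < t" by (simp add: eventually_at_right_less)
    ultimately have "\<forall>\<^sub>F t in at_right 0. 0 < t \<and> x + t *\<^sub>R v \<in> centered_box a"
      by eventually_elim auto
    then obtain t :: real where t: "0 < t" "x + t *\<^sub>R v \<in> centered_box a"
      using eventually_happens'[OF trivial_limit_at_right_real] by blast
    have "- (a $ j) < x $ j + t * v $ j" "x $ j + t * v $ j < a $ j"
      using t(2) by (auto simp: centered_box_def)
    then have "t * (s * v $ j) < 0" using xj s' by auto
    then show ?thesis using t(1) by (simp add: mult_less_0_iff)
  qed
  define e where "e = axis j s"
  have ee: "e \<bullet> e = 1" "v \<bullet> e = s * v $ j" for v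
    using s' by (auto simp: e_def inner_axis)
  have "n \<bullet> e = 1"
  proof (rule ccontr)
    assume "n \<bullet> e \<noteq> 1"
    moreover have "n \<bullet> e \<le> 1"
      using norm_cauchy_schwarz[of n e] n1 ee(1) by (simp add: norm_eq_1[symmetric])
    ultimately have lt: "n \<bullet> e < 1" by simp
    \<comment> \<open>For unit vectors \<open>n \<noteq> e\<close>, this direction lies strictly inside the half-space of \<open>n\<close> and strictly outside that of \<open>e\<close>.\<close>
    let ?v = "e - n"
    have "?v \<bullet> n < 0" using nn lt by (simp add: inner_diff_left inner_commute[of e])
    then have "s * ?v $ j < 0" by (rule half)
    moreover have "s * ?v $ j = 1 - n \<bullet> e" 
      using ee(1) ee(2)[of ?v] by (simp add: inner_diff_left)
    ultimately show False using lt by simp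
  qed
  then have "(n - e) \<bullet> (n - e) = 0"
    using nn ee(1) by (simp add: inner_diff_left inner_diff_right inner_commute)
  then have "n = axis j s" by (simp add: e_def)
  then show ?thesis using that s xj by blast
qed

section \<open>The ground state\<close>

lemma cosine_mode_eigenfunction:
  fixes a :: "real ^ 'n"
  assumes \<beta>: "0 \<le> \<beta>" and a: "\<forall>j. 0 < a $ j" and \<nu>: "\<And>j. robin_defect \<beta> (a $ j) (\<nu> j) = 0"
  shows "robin_eigenfunction \<beta> (centered_box a) (\<Sum>j\<in>UNIV. (\<nu> j)\<^sup>2) (cosine_mode \<nu>)"
  unfolding robin_eigenfunction_def
proof (intro conjI exI[of _ "cosine_mode_grad \<nu>"] exI[of _ "cosine_mode_hess \<nu>"] ballI impI allI)
  have "0 \<in> centered_box a" using a by (simp add: centered_box_def)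
  moreover have "cosine_mode \<nu> 0 \<noteq> 0" by (simp add: cosine_mode_def separable_product_def)
  ultimately show "\<exists>x\<in>centered_box a. cosine_mode \<nu> x \<noteq> 0" by blast
  show "continuous_on (closure (centered_box a)) (cosine_mode \<nu>)"
    "continuous_on (closure (centered_box a)) (cosine_mode_grad \<nu>)"
    by (rule continuous_on_cosine_mode continuous_on_cosine_mode_grad)+
  show "continuous_on (centered_box a) (cosine_mode_hess \<nu>)"
    by (rule continuous_on_cosine_mode_hess)
next
  fix x n assume "outward_normal (centered_box a) x n"
  then obtain j s where "\<bar>s\<bar> = 1" "x $ j = s * a $ j" "n = axis j s"
    by (rule outward_normal_centered_boxE[OF a])
  then show "\<beta> * (cosine_mode_grad \<nu> x \<bullet> n) + cosine_mode \<nu> x = 0"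
    using cosine_mode_boundary_operator[of s x j "a $ j" \<beta> \<nu>] \<nu>[of j]
    by (simp add: inner_axis mult.commute)
qed (auto simp: trace_cosine_mode_hess has_derivative_cosine_mode has_derivative_cosine_mode_grad
      has_derivative_at_withinI)

section \<open>Comparison with a strict supersolution\<close>

text \<open>
  The one-dimensional second derivative test along the \<open>j\<close>-th axis: were the second derivative
  positive, the first derivative, zero at the maximum, would be positive just after it, and the
  function would increase.
\<close>
lemma hessian_diagonal_nonpos_at_maximum:
  fixes z :: "real ^ 'n \<Rightarrow> real" and H :: "real ^ 'n \<Rightarrow> real ^ 'n ^ 'n"
  assumes S: "open S" "x \<in> S"
    and z: "\<And>y. y \<in> S \<Longrightarrow> (z has_derivative (\<lambda>h. g y \<bullet> h)) (at y)"
    and g: "(g has_derivative (\<lambda>h. H x *v h)) (at x)"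
    and max: "\<And>y. y \<in> S \<Longrightarrow> z y \<le> z x"
  shows "H x $ j $ j \<le> 0"
proof (rule ccontr)
  assume "\<not> H x $ j $ j \<le> 0"
  then have pos: "0 < H x $ j $ j" by simp
  let ?e = "axis j 1 :: real ^ 'n"
  define \<phi> where "\<phi> t = z (x + t *\<^sub>R ?e)" for t :: real
  define \<psi> where "\<psi> t = g (x + t *\<^sub>R ?e) $ j" for t :: real
  have line: "((\<lambda>t. x + t *\<^sub>R ?e) has_derivative (\<lambda>h. h *\<^sub>R ?e)) (at t)" for t :: real
    by (auto intro!: derivative_eq_intros)
  have \<phi>': "(\<phi> has_real_derivative \<psi> t) (at t)" if "x + t *\<^sub>R ?e \<in> S" for t
    using has_derivative_compose[OF line z[OF that]]
    by (simp add: has_field_derivative_def \<phi>_def[abs_def] \<psi>_def inner_axis mult.commute[of _ "_ $ j"])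
  have "((\<lambda>t. g (x + t *\<^sub>R ?e)) has_derivative (\<lambda>h. H x *v (h *\<^sub>R ?e))) (at 0)"
    using has_derivative_compose[OF line[of 0], of g] g by simp
  from has_derivative_compose[OF this bounded_linear_imp_has_derivative[OF bounded_linear_vec_nth[of j]]]
  have \<psi>': "(\<psi> has_real_derivative H x $ j $ j) (at 0)"
    by (simp add: has_field_derivative_def \<psi>_def[abs_def] matrix_vector_mult_scaleR
        matrix_vector_mult_basis column_def mult.commute[of _ "_ $ j"])
  obtain d where d: "0 < d" and ball: "ball x d \<subseteq> S" using S openE by blast
  have inS: "x + t *\<^sub>R ?e \<in> S" if "\<bar>t\<bar> < d" for t
    using that ball by (auto simp: subset_iff dist_norm norm_eq_sqrt_inner inner_axis_axis)
  have "\<psi> 0 = 0"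
  proof (rule DERIV_local_max)
    show "(\<phi> has_real_derivative \<psi> 0) (at 0)" using inS[of 0] d by (intro \<phi>') simp
    show "\<forall>y. \<bar>0 - y\<bar> < d \<longrightarrow> \<phi> y \<le> \<phi> 0" using max inS by (simp add: \<phi>_def)
  qed (rule d)
  then obtain d' where d': "0 < d'" and inc: "\<And>h. 0 < h \<Longrightarrow> h < d' \<Longrightarrow> 0 < \<psi> h"
    using DERIV_pos_inc_right[OF \<psi>' pos] by auto
  define b where "b = min d d' / 2"
  have b: "0 < b" "b < d" "b < d'" using d d' by (auto simp: b_def)
  have "\<phi> 0 < \<phi> b"
  proof (rule DERIV_pos_imp_increasing_open[OF b(1)])
    show "\<exists>y. (\<phi> has_real_derivative y) (at t) \<and> 0 < y" if "0 < t" "t < b" for t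
      using that b inS[of t] by (intro exI[of _ "\<psi> t"] conjI \<phi>' inc) auto
    show "continuous_on {0..b} \<phi>"
      using b inS by (intro DERIV_continuous_on[where D = \<psi>] DERIV_subset[OF \<phi>']) auto
  qed
  moreover have "\<phi> b \<le> \<phi> 0" using max[OF inS[of b]] b by (simp add: \<phi>_def)
  ultimately show False by simp
qed

text \<open>
  Moving from \<open>x\<close> straight inward, in direction \<open>- s e\<^sub>j\<close>, stays in the closed box even when \<open>x\<close> is
  on an edge or a corner, and cannot increase \<open>z\<close>.
\<close>
lemma normal_derivative_nonneg_at_maximum:
  fixes z :: "real ^ 'n \<Rightarrow> real"
  assumes s: "\<bar>s\<bar> = 1" and xj: "x $ j = s * a $ j" and a: "\<forall>j. 0 < a $ j"
    and x: "x \<in> closure (centered_box a)"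
    and z: "(z has_derivative (\<lambda>h. g \<bullet> h)) (at x within closure (centered_box a))"
    and max: "\<And>y. y \<in> closure (centered_box a) \<Longrightarrow> z y \<le> z x"
  shows "0 \<le> s * g $ j"
proof (rule ccontr)
  assume "\<not> 0 \<le> s * g $ j"
  then have neg: "0 < - (s * g $ j)" by simp
  have s': "s = 1 \<or> s = -1" using s by linarith
  let ?c = "\<lambda>t. x + t *\<^sub>R axis j (- s)"
  have C: "?c t \<in> closure (centered_box a)" if "t \<in> {0..a $ j}" for t
    unfolding closure_centered_box[OF a] mem_Collect_eq
  proof
    fix i show "\<bar>?c t $ i\<bar> \<le> a $ i"
      using x that xj s' unfolding closure_centered_box[OF a]
      by (cases "i = j") (auto simp: axis_def)
  qed
  have "(z has_derivative (\<lambda>h. g \<bullet> h)) (at (?c 0) within ?c ` {0..a $ j})"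
    using C by (auto intro!: has_derivative_subset[OF z])
  moreover have "(?c has_derivative (\<lambda>h. h *\<^sub>R axis j (- s))) (at 0 within {0..a $ j})"
    by (auto intro!: derivative_eq_intros)
  ultimately have "((\<lambda>t. z (?c t)) has_derivative (\<lambda>h. g \<bullet> (h *\<^sub>R axis j (- s)))) (at 0 within {0..a $ j})"
    using has_derivative_in_compose by blast
  moreover have "(\<lambda>h. g \<bullet> (h *\<^sub>R axis j (- s))) = (*) (- (s * g $ j))"
    by (auto simp: fun_eq_iff inner_axis)
  ultimately have "((\<lambda>t. z (?c t)) has_real_derivative (- (s * g $ j))) (at 0 within {0..a $ j})"
    by (simp add: has_field_derivative_def)
  from has_real_derivative_pos_inc_right[OF this neg] obtain d where
    d: "0 < d" "\<And>h. 0 < h \<Longrightarrow> h \<in> {0..a $ j} \<Longrightarrow> h < d \<Longrightarrow> z x < z (?c h)" by auto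
  define h where "h = min d (a $ j) / 2"
  have h: "0 < h" "h \<in> {0..a $ j}" "h < d" using d(1) a[rule_format, of j] by (auto simp: h_def)
  show False using d(2)[OF h] max[OF C[OF h(2)]] by simp
qed

text \<open>
  The boundary condition is imposed only where a normal exists, that is, in the relative interior of
  faces.  Every point of a closed face is a limit of such points, and the condition passes to the limit
  because \<open>u\<close>, and for \<open>\<beta> \<noteq> 0\<close> also the gradient, is continuous on the closed box.
\<close>
lemma robin_condition_on_closed_faces:
  fixes g :: "real ^ 'n \<Rightarrow> real ^ 'n"
  assumes a: "\<forall>j. 0 < a $ j" and s: "\<bar>s\<bar> = 1" and xj: "x $ j = s * a $ j"
    and x: "x \<in> closure (centered_box a)"
    and u: "continuous_on (closure (centered_box a)) u"
    and g: "\<beta> \<noteq> 0 \<Longrightarrow> continuous_on (closure (centered_box a)) g"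
    and robin: "\<And>y n. outward_normal (centered_box a) y n \<Longrightarrow> \<beta> * (g y \<bullet> n) + u y = 0"
  shows "\<beta> * (s * g x $ j) + u x = 0"
proof -
  have s': "s = 1 \<or> s = -1" using s by linarith
  let ?C = "closure (centered_box a)"
  \<comment> \<open>Contracting all coordinates but the \<open>j\<close>-th moves \<open>x\<close> into the relative interior of its face.\<close>
  define p where "p t = (\<chi> i. if i = j then x $ i else (1 - t) * x $ i)" for t
  define F where "F y = \<beta> * (s * g y $ j) + u y" for y
  have xi: "\<bar>x $ i\<bar> \<le> a $ i" for i using x by (simp add: closure_centered_box[OF a])
  have small: "\<bar>(1 - t) * x $ i\<bar> < a $ i" if "0 < t" "t \<le> 1" for t i
  proof -
    have "\<bar>(1 - t) * x $ i\<bar> \<le> (1 - t) * a $ i"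
      using that xi[of i] by (simp add: abs_mult mult_left_mono)
    also have "\<dots> < a $ i" using that a[rule_format, of i] by (simp add: algebra_simps)
    finally show ?thesis .
  qed
  have F0: "F (p t) = 0" if "0 < t" "t \<le> 1" for t
  proof -
    have "outward_normal (centered_box a) (p t) (axis j s)"
      using small[OF that] by (intro outward_normal_centered_box_face a s) (auto simp: p_def xj)
    from robin[OF this] show ?thesis by (simp add: F_def inner_axis mult.commute)
  qed
  have p0: "p 0 = x" by (simp add: p_def vec_eq_iff)
  have pC: "p t \<in> ?C" if "t \<in> {0..1}" for t
  proof (cases "t = 0")
    case False
    then have "\<bar>p t $ i\<bar> \<le> a $ i" for i
      using small[of t i] xi[of i] that by (cases "i = j") (simp_all add: p_def)
    then show ?thesis by (simp add: closure_centered_box[OF a])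
  qed (use p0 x in simp)
  have "continuous_on ?C F"
    unfolding F_def using u g by (cases "\<beta> = 0") (auto intro!: continuous_intros)
  moreover have "continuous_on {0..1} p"
    unfolding p_def
  proof (intro continuous_on_vec_lambda)
    fix i show "continuous_on {0..1} (\<lambda>t. if i = j then x $ i else (1 - t) * x $ i)"
      by (cases "i = j") (auto intro!: continuous_intros)
  qed
  moreover have "p ` {0..1} \<subseteq> ?C" using pC by blast
  ultimately have "continuous_on {0..1} (\<lambda>t. F (p t))"
    by (rule continuous_on_compose2)
  then have "((\<lambda>t. F (p t)) \<longlongrightarrow> F (p 0)) (at 0 within {0..1})"
    unfolding continuous_on_def by (rule bspec) simp
  then have "((\<lambda>t. F (p t)) \<longlongrightarrow> F (p 0)) (at_right 0)"
    by (simp add: at_within_Icc_at_right)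
  moreover have "\<forall>\<^sub>F t in at_right (0::real). F (p t) = 0"
    unfolding eventually_at_right_field using F0 by (intro exI[of _ 1]) simp
  then have "((\<lambda>t. F (p t)) \<longlongrightarrow> 0) (at_right 0)" by (rule tendsto_eventually)
  ultimately have "F (p 0) = 0"
    using tendsto_unique[OF trivial_limit_at_right_real] by blast
  then show ?thesis by (simp add: p0 F_def)
qed

lemma robin_eigenfunction_uminus:
  assumes "robin_eigenfunction \<beta> \<Omega> lam u"
  shows "robin_eigenfunction \<beta> \<Omega> lam (\<lambda>x. - u x)"
proof -
  obtain g H where *: "\<exists>x\<in>\<Omega>. u x \<noteq> 0" "continuous_on (closure \<Omega>) u"
    "\<forall>x\<in>\<Omega>. (u has_derivative (\<lambda>h. g x \<bullet> h)) (at x)"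
    "\<forall>x\<in>\<Omega>. (g has_derivative (\<lambda>h. H x *v h)) (at x)" "continuous_on \<Omega> H"
    "\<beta> \<noteq> 0 \<longrightarrow> continuous_on (closure \<Omega>) g \<and>
       (\<forall>x\<in>closure \<Omega>. (u has_derivative (\<lambda>h. g x \<bullet> h)) (at x within closure \<Omega>))"
    "\<forall>x\<in>\<Omega>. trace (H x) + lam * u x = 0"
    "\<forall>x n. outward_normal \<Omega> x n \<longrightarrow> \<beta> * (g x \<bullet> n) + u x = 0"
    using assms unfolding robin_eigenfunction_def by blast
  have du: "((\<lambda>x. - u x) has_derivative (\<lambda>h. - g y \<bullet> h)) (at y within T)"
    if "(u has_derivative (\<lambda>h. g y \<bullet> h)) (at y within T)" for y T
    using has_derivative_minus[OF that] by simp
  have "- A *v h = - (A *v h)" for A :: "real ^ 'a ^ 'a" and h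
    by (simp add: matrix_vector_mult_def vec_eq_iff sum_negf)
  then have dg: "((\<lambda>x. - g x) has_derivative (\<lambda>h. - H y *v h)) (at y)"
    if "(g has_derivative (\<lambda>h. H y *v h)) (at y)" for y
    using has_derivative_minus[OF that] by simp
  have tr: "trace (- A) = - trace A" for A :: "real ^ 'a ^ 'a"
    by (simp add: trace_def sum_negf)
  show ?thesis
    unfolding robin_eigenfunction_def
  proof (intro conjI exI[of _ "\<lambda>x. - g x"] exI[of _ "\<lambda>x. - H x"] ballI impI allI)
    fix x assume "x \<in> \<Omega>"
    then have "trace (H x) + lam * u x = 0" using *(7) by blast
    then show "trace (- H x) + lam * - u x = 0" by (simp add: tr)
  next
    fix x n assume "outward_normal \<Omega> x n"
    then have "\<beta> * (g x \<bullet> n) + u x = 0" using *(8) by blast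
    then show "\<beta> * (- g x \<bullet> n) + - u x = 0" by simp
  qed (use * in \<open>auto intro: du dg continuous_on_minus\<close>)
qed

text \<open>
  The maximum principle.  Frequencies with positive defect make the cosine mode a strict
  supersolution of the Robin condition; being below \<open>\<pi>/(2a\<^sub>j)\<close>, they keep it positive on the closed
  box, so it can be compared with an eigenfunction by scaling.
\<close>
lemma eigenvalue_ge_subcritical_frequencies:
  fixes a :: "real ^ 'n"
  assumes \<beta>: "0 \<le> \<beta>" and a: "\<forall>j. 0 < a $ j"
    and eig: "robin_eigenvalue \<beta> (centered_box a) lam"
    and \<nu>: "\<And>j. 0 \<le> \<nu> j" "\<And>j. \<nu> j < pi / (2 * a $ j)"
    and sub: "\<And>j. 0 < robin_defect \<beta> (a $ j) (\<nu> j)"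
  shows "(\<Sum>j\<in>UNIV. (\<nu> j)\<^sup>2) \<le> lam"
proof (rule ccontr)
  let ?\<Omega> = "centered_box a"
  let ?C = "closure ?\<Omega>"
  let ?\<Lambda> = "\<Sum>j\<in>UNIV. (\<nu> j)\<^sup>2"
  let ?w = "cosine_mode \<nu>" and ?gw = "cosine_mode_grad \<nu>" and ?Hw = "cosine_mode_hess \<nu>"
  assume "\<not> ?\<Lambda> \<le> lam"
  then have lam: "lam < ?\<Lambda>" by simp
  obtain u where u: "robin_eigenfunction \<beta> ?\<Omega> lam u" and "\<exists>x\<in>?\<Omega>. 0 < u x"
  proof -
    obtain u where u: "robin_eigenfunction \<beta> ?\<Omega> lam u"
      using eig by (auto simp: robin_eigenvalue_def)
    then obtain x where "x \<in> ?\<Omega>" "u x \<noteq> 0" by (auto simp: robin_eigenfunction_def)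
    then have "(\<exists>x\<in>?\<Omega>. 0 < u x) \<or> (\<exists>x\<in>?\<Omega>. 0 < - u x)" by force
    then show ?thesis using that u robin_eigenfunction_uminus[OF u] by blast
  qed
  then obtain x1 where x1: "x1 \<in> ?\<Omega>" "0 < u x1" by blast
  obtain g H where cu: "continuous_on ?C u"
    and du: "\<And>x. x \<in> ?\<Omega> \<Longrightarrow> (u has_derivative (\<lambda>h. g x \<bullet> h)) (at x)"
    and dg: "\<And>x. x \<in> ?\<Omega> \<Longrightarrow> (g has_derivative (\<lambda>h. H x *v h)) (at x)"
    and cg: "\<beta> \<noteq> 0 \<Longrightarrow> continuous_on ?C g"
    and duC: "\<And>x. \<beta> \<noteq> 0 \<Longrightarrow> x \<in> ?C \<Longrightarrow> (u has_derivative (\<lambda>h. g x \<bullet> h)) (at x within ?C)"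
    and pde: "\<And>x. x \<in> ?\<Omega> \<Longrightarrow> trace (H x) + lam * u x = 0"
    and robin: "\<And>x n. outward_normal ?\<Omega> x n \<Longrightarrow> \<beta> * (g x \<bullet> n) + u x = 0"
    using u unfolding robin_eigenfunction_def by blast
  have cos_pos: "0 < cos (\<nu> j * x $ j)" if "x \<in> ?C" for x j
  proof -
    have "\<bar>\<nu> j * x $ j\<bar> \<le> \<nu> j * a $ j"
      using that \<nu>(1)[of j] by (simp add: closure_centered_box[OF a] abs_mult mult_left_mono)
    also have "\<dots> < pi / 2" using \<nu>(2)[of j] a[rule_format, of j] by (simp add: field_simps)
    finally show ?thesis by (intro cos_gt_zero_pi) linarith+
  qed
  have w_pos: "0 < ?w x" if "x \<in> ?C" for x
    unfolding cosine_mode_def separable_product_def by (intro prod_pos) (simp add: cos_pos that)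
  have cw: "continuous_on ?C ?w" by (rule continuous_on_cosine_mode)
  have "compact ?C" by (simp add: centered_box_eq_box compact_closure)
  moreover have "?C \<noteq> {}" using x1 closure_subset by blast
  moreover have "continuous_on ?C (\<lambda>x. u x / ?w x)"
    using cu cw w_pos by (intro continuous_on_divide) (auto simp: less_imp_neq[THEN not_sym])
  ultimately have "\<exists>x\<in>?C. \<forall>y\<in>?C. u y / ?w y \<le> u x / ?w x"
    by (rule continuous_attains_sup)
  then obtain x0 where x0: "x0 \<in> ?C" and max: "\<And>y. y \<in> ?C \<Longrightarrow> u y / ?w y \<le> u x0 / ?w x0"
    by blast
  define M where "M = u x0 / ?w x0"
  have x1C: "x1 \<in> ?C" using x1 closure_subset by blast
  have M: "0 < M"
  proof -
    have "0 < u x1 / ?w x1" using x1 w_pos[OF x1C] by simp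
    also have "\<dots> \<le> M" using max[OF x1C] by (simp add: M_def)
    finally show ?thesis .
  qed
  define z where "z x = u x - M * ?w x" for x
  have z0: "z x0 = 0" using w_pos[OF x0] by (simp add: z_def M_def)
  have z_le: "z y \<le> z x0" if "y \<in> ?C" for y
    using max[OF that] w_pos[OF that] by (simp add: z0) (simp add: z_def M_def[symmetric] field_simps)
  show False
  proof (cases "x0 \<in> ?\<Omega>")
    case True
    have "(H x0 - M *\<^sub>R ?Hw x0) $ j $ j \<le> 0" for j
    proof (rule hessian_diagonal_nonpos_at_maximum[of ?\<Omega> _ z "\<lambda>x. g x - M *\<^sub>R ?gw x"
          "\<lambda>x. H x - M *\<^sub>R ?Hw x"])
      show "(z has_derivative (\<lambda>h. (g y - M *\<^sub>R ?gw y) \<bullet> h)) (at y)" if "y \<in> ?\<Omega>" for y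
        unfolding z_def
        by (auto intro!: derivative_eq_intros du[OF that] has_derivative_cosine_mode
            simp: inner_diff_left)
      show "((\<lambda>x. g x - M *\<^sub>R ?gw x) has_derivative (*v) (H x0 - M *\<^sub>R ?Hw x0)) (at x0)"
        by (auto intro!: derivative_eq_intros dg[OF True] has_derivative_cosine_mode_grad
            simp: matrix_vector_mult_diff_rdistrib scaleR_matrix_vector_assoc)
    qed (use True open_centered_box z_le closure_subset in auto)
    then have "trace (H x0 - M *\<^sub>R ?Hw x0) \<le> 0"
      unfolding trace_def by (intro sum_nonpos) blast
    then have "trace (H x0) - M * trace (?Hw x0) \<le> 0"
      by (simp add: trace_def sum_subtractf sum_distrib_left)
    moreover have "u x0 = M * ?w x0" using z0 by (simp add: z_def)
    ultimately have "(?\<Lambda> - lam) * (M * ?w x0) \<le> 0"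
      using pde[OF True] by (simp add: trace_cosine_mode_hess algebra_simps)
    moreover have "0 < (?\<Lambda> - lam) * (M * ?w x0)" using lam M w_pos[OF x0] by simp
    ultimately show False by simp
  next
    case False
    then have "x0 \<in> frontier ?\<Omega>"
      using x0 by (simp add: frontier_def interior_open[OF open_centered_box])
    then obtain j s where s: "\<bar>s\<bar> = 1" and xj: "x0 $ j = s * a $ j"
      by (auto simp: frontier_centered_box[OF a])
    let ?G = "g x0 - M *\<^sub>R ?gw x0"
    have "\<beta> * (s * g x0 $ j) + u x0 = 0"
      using robin_condition_on_closed_faces[OF a s xj x0 cu cg robin] .
    moreover have "0 < \<beta> * (s * ?gw x0 $ j) + ?w x0"
      unfolding cosine_mode_boundary_operator[OF s xj]
      by (intro mult_pos_pos sub prod_pos) (simp add: cos_pos x0)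
    then have "0 < M * (\<beta> * (s * ?gw x0 $ j) + ?w x0)" using M by simp
    ultimately have neg: "\<beta> * (s * ?G $ j) < 0"
      using z0 by (simp add: z_def algebra_simps)
    \<comment> \<open>For \<open>\<beta> = 0\<close> this is already absurd; only for \<open>\<beta> > 0\<close> is the gradient available on the boundary.\<close>
    then have \<beta>0: "\<beta> \<noteq> 0" by auto
    have "(z has_derivative (\<lambda>h. ?G \<bullet> h)) (at x0 within ?C)"
      unfolding z_def
      by (auto intro!: derivative_eq_intros duC[OF \<beta>0 x0]
          has_derivative_at_withinI[OF has_derivative_cosine_mode] simp: inner_diff_left)
    then have "0 \<le> s * ?G $ j"
      by (rule normal_derivative_nonneg_at_maximum[OF s xj a x0]) (rule z_le)
    then have "0 \<le> \<beta> * (s * ?G $ j)" using \<beta> by (rule mult_nonneg_nonneg[rotated])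
    then show False using neg by linarith
  qed
qed

section \<open>The fundamental eigenvalue of a box and its monotonicity\<close>

text \<open>
  The explicit formula for the least eigenvalue.  The lower bound holds for the frequencies scaled by
  any factor below 1, where the defect is positive, and hence in the limit.
\<close>
theorem fundamental_eigenvalue_centered_box:
  fixes a :: "real ^ 'n"
  assumes \<beta>: "0 \<le> \<beta>" and a: "\<forall>j. 0 < a $ j"
  shows "fundamental_eigenvalue \<beta> (centered_box a) = (\<Sum>j\<in>UNIV. (robin_frequency \<beta> (a $ j))\<^sup>2)"
  unfolding fundamental_eigenvalue_def
proof (rule Least_equality)
  note \<mu> = robin_frequency[OF \<beta> a[rule_format]]
  show "robin_eigenvalue \<beta> (centered_box a) (\<Sum>j\<in>UNIV. (robin_frequency \<beta> (a $ j))\<^sup>2)"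
    unfolding robin_eigenvalue_def using cosine_mode_eigenfunction[OF \<beta> a \<mu>(3)] by blast
  fix lam assume eig: "robin_eigenvalue \<beta> (centered_box a) lam"
  show "(\<Sum>j\<in>UNIV. (robin_frequency \<beta> (a $ j))\<^sup>2) \<le> lam"
  proof (rule field_le_mult_one_interval)
    fix r :: real assume r: "0 < r" "r < 1"
    \<comment> \<open>The square root makes the sum of the squared frequencies exactly \<open>r\<close> times the target.\<close>
    let ?\<nu> = "\<lambda>j. sqrt r * robin_frequency \<beta> (a $ j)"
    have lt: "?\<nu> j < robin_frequency \<beta> (a $ j)" for j using r \<mu>(1)[of j] by simp
    have ge: "0 \<le> ?\<nu> j" for j using r \<mu>(1)[of j] by simp
    have "(\<Sum>j\<in>UNIV. (?\<nu> j)\<^sup>2) \<le> lam"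
    proof (rule eigenvalue_ge_subcritical_frequencies[OF \<beta> a eig])
      show "0 \<le> ?\<nu> j" for j by (rule ge)
      show "?\<nu> j < pi / (2 * a $ j)" for j using lt[of j] \<mu>(2)[of j] by simp
      show "0 < robin_defect \<beta> (a $ j) (?\<nu> j)" for j
        using robin_defect_strict_antimono[OF \<beta> a[rule_format] ge lt \<mu>(2), of j] \<mu>(3)[of j] by simp
    qed
    then show "r * (\<Sum>j\<in>UNIV. (robin_frequency \<beta> (a $ j))\<^sup>2) \<le> lam"
      using r by (simp add: power_mult_distrib sum_distrib_left)
  qed
qed

theorem theorem7:
  fixes \<beta> :: real and \<Omega>\<^sub>1 \<Omega>\<^sub>2 :: "(real ^ 'n) set"
  assumes "\<beta> \<ge> 0"
    and "is_centered_box \<Omega>\<^sub>1" and "is_centered_box \<Omega>\<^sub>2"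
    and "\<Omega>\<^sub>1 \<subseteq> \<Omega>\<^sub>2"
  shows "fundamental_eigenvalue \<beta> \<Omega>\<^sub>1 \<ge> fundamental_eigenvalue \<beta> \<Omega>\<^sub>2"
proof -
  obtain a b where a: "\<forall>j. 0 < a $ j" "\<Omega>\<^sub>1 = centered_box a"
    and b: "\<forall>j. 0 < b $ j" "\<Omega>\<^sub>2 = centered_box b"
    using assms by (auto simp: is_centered_box_def)
  \<comment> \<open>The half-widths are compared by looking at the extreme corner of the smaller closed box.\<close>
  have "a \<in> closure \<Omega>\<^sub>1" using a by (simp add: closure_centered_box less_imp_le)
  then have "a \<in> closure \<Omega>\<^sub>2" using closure_mono[OF assms(4)] by blast
  then have ab: "a $ j \<le> b $ j" for j
    using b by (simp add: closure_centered_box) (metis abs_le_D1)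
  show ?thesis
    unfolding a(2) b(2) fundamental_eigenvalue_centered_box[OF assms(1) a(1)]
      fundamental_eigenvalue_centered_box[OF assms(1) b(1)]
    using a(1) b(1) ab assms(1)
    by (intro sum_mono power_mono robin_frequency_antimono) (auto intro: less_imp_le robin_frequency)
qed

end
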